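(* Let $V(x)=\tanh(x-2)-\tanh(-2)$, let $\bar v\in(0,1+\tanh 2)$ and $X_\infty=V^{-1}(\bar v)>0$, and let $\xi_{1,\circ}\in(0,X_\infty)$ and $\zeta_{1,\circ}>0$. Then there exist $\alpha_0,\beta_0>0$ (depending on $\bar v,\xi_{1,\circ},\zeta_{1,\circ}$) such that for all $\alpha\ge\alpha_0$, $\beta\ge\beta_0$ and all $(\xi_{2,\circ},\zeta_{2,\circ})\in(0,\infty)\times\mathbb R$ the following holds. Let $[0,\mathcal T^c)$ be the maximal forward interval of existence, in the state space $\mathcal D=((0,\infty)\times\mathbb R)^2$, of the solution $(\xi_1,\zeta_1,\xi_2,\zeta_2)$ of $$\begin{cases}\dot\xi_1=\zeta_1,\\ \dot\zeta_1=-\alpha\{V(\xi_1)-\bar v\}-\alpha\zeta_1-\beta\,\dfrac{\zeta_1}{\xi_1^2},\\ \dot\xi_2=\zeta_2,\\ \dot\zeta_2=-\alpha\{V(\xi_2)-V(\xi_1)\}-\alpha\zeta_2-\beta\left(\dfrac{\zeta_2}{\xi_2^2}-\dfrac{\zeta_1}{\xi_1^2}\right),\end{cases}$$ with initial value $(\xi_1,\zeta_1,\xi_2,\zeta_2)(0)=(\xi_{1,\circ},\zeta_{1,\circ},\xi_{2,\circ},\zeta_{2,\circ})$. Then $\mathcal T^c=\infty$; that is, no collision occurs: the solution exists for all $t\ge 0$ with $\xi_2(t)>0$.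
   Context: This is the optimal velocity follow-the-leader model for three vehicles in difference coordinates: the lead vehicle moves with constant velocity $\bar v$; $\xi_1$ is the distance between the lead vehicle and the second vehicle, $\xi_2$ the distance between the second and the third vehicle, and $\zeta_i=\dot\xi_i$. A collision between the second and third vehicles means $\xi_2=0$. The function $V:\mathbb R\to\mathbb R$ is strictly increasing with $V(0)=0$ and $\lim_{x\to\infty}V(x)=1+\tanh 2$. *)

theory Defs
  imports "HOL-Analysis.Analysis"
begin

definition optimal_velocity :: "real \<Rightarrow> real" where
  "optimal_velocity x = tanh (x - 2) - tanh (- 2)"

text \<open>
  States are grouped as ((\<open>\<xi>\<^sub>1\<close>, \<open>\<zeta>\<^sub>1\<close>), (\<open>\<xi>\<^sub>2\<close>, \<open>\<zeta>\<^sub>2\<close>)).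
\<close>

type_synonym state = "(real \<times> real) \<times> (real \<times> real)"

definition state_space :: "state set" where
  "state_space = ({0<..} \<times> UNIV) \<times> ({0<..} \<times> UNIV)"

fun ftl_field :: "real \<Rightarrow> real \<Rightarrow> real \<Rightarrow> state \<Rightarrow> state" where
  "ftl_field \<alpha> \<beta> vbar ((\<xi>1, \<zeta>1), (\<xi>2, \<zeta>2)) =
    ((\<zeta>1,
      - \<alpha> * (optimal_velocity \<xi>1 - vbar) - \<alpha> * \<zeta>1 - \<beta> * (\<zeta>1 / \<xi>1\<^sup>2)),
     (\<zeta>2,
      - \<alpha> * (optimal_velocity \<xi>2 - optimal_velocity \<xi>1) - \<alpha> * \<zeta>2
        - \<beta> * (\<zeta>2 / \<xi>2\<^sup>2 - \<zeta>1 / \<xi>1\<^sup>2)))"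

definition forward_interval :: "ereal \<Rightarrow> real set" where
  "forward_interval T = {t. 0 \<le> t \<and> ereal t < T}"

definition solves_ivp ::
    "('a::real_normed_vector \<Rightarrow> 'a) \<Rightarrow> 'a set \<Rightarrow> 'a \<Rightarrow> real set \<Rightarrow> (real \<Rightarrow> 'a) \<Rightarrow> bool" where
  "solves_ivp f D x0 J x \<longleftrightarrow>
    x 0 = x0 \<and>
    (\<forall>t\<in>J. x t \<in> D \<and> (x has_vector_derivative f (x t)) (at t within J))"

text \<open>
  Only the values of \<open>x\<close> on \<open>[0, T)\<close> matter. For open \<open>D\<close> and continuous \<open>f\<close>, admitting
  extensions to closed intervals \<open>[0, S]\<close> as well would not change the notion of maximality.
\<close>

definition maximal_forward_solution ::
    "('a::real_normed_vector \<Rightarrow> 'a) \<Rightarrow> 'a set \<Rightarrow> 'a \<Rightarrow> ereal \<Rightarrow> (real \<Rightarrow> 'a) \<Rightarrow> bool" where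
  "maximal_forward_solution f D x0 T x \<longleftrightarrow>
    0 < T \<and>
    solves_ivp f D x0 (forward_interval T) x \<and>
    \<not> (\<exists>S y. T < S \<and> solves_ivp f D x0 (forward_interval S) y \<and>
              (\<forall>t\<in>forward_interval T. y t = x t))"

end

theory Submission
  imports Defs
begin

text \<open>
  The drag terms are exact derivatives: \<open>\<zeta>\<^sub>1 + \<alpha> \<xi>\<^sub>1 - \<beta> / \<xi>\<^sub>1\<close> and
  \<open>\<zeta>\<^sub>2 + \<alpha> \<xi>\<^sub>2 - \<beta> / \<xi>\<^sub>2 + \<beta> / \<xi>\<^sub>1\<close> have bounded derivatives because the optimal velocity is
  bounded, so they stay bounded on bounded time intervals. Hence \<open>\<zeta>\<^sub>i\<close> is positive wherever \<open>\<xi>\<^sub>i\<close>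
  is small and negative wherever \<open>\<xi>\<^sub>i\<close> is large, which keeps the trajectory in a compact
  subset of the state space on every bounded time interval; Picard's theorem then continues it.
  No lower bound on \<open>\<alpha>, \<beta> > 0\<close> enters, so \<open>\<alpha>\<^sub>0 = \<beta>\<^sub>0 = 1\<close> serves.
\<close>

subsection \<open>Local existence\<close>

text \<open>Picard iteration as a contraction: the integral operator on bounded continuous functions
  has Lipschitz constant at most \<open>L * h\<close>, and its fixed point solves the integral
  equation.\<close>

lemma picard_global_lipschitz:
  fixes f :: "'a::banach \<Rightarrow> 'a"
  assumes L: "L-lipschitz_on UNIV f"
  obtains h x where "h > 0" "x 0 = p"
    "\<And>t. t \<in> {0..h} \<Longrightarrow> (x has_vector_derivative f (x t)) (at t within {0..h})"
proof -
  have L0: "L \<ge> 0" using lipschitz_on_nonneg[OF L] .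
  have contf: "continuous_on UNIV f"
    using L by (rule lipschitz_on_continuous_on)
  \<comment> \<open>The \<open>+ 1\<close> keeps the quotient defined when \<open>L = 0\<close>,
    while \<open>L * h\<close> stays below one half.\<close>
  define h where "h = 1 / (2 * (L + 1))"
  have h: "h > 0" and Lh: "L * h < 1"
    using L0 by (auto simp: h_def field_simps)
  \<comment> \<open>Clamping time to \<open>{0..h}\<close> yields a function on the whole line that
    is constant outside \<open>{0..h}\<close>, hence bounded. The complete type of bounded
    continuous functions can then host the fixed point argument.\<close>
  define \<Phi> where "\<Phi> x = (\<lambda>t. p + integral {0..min h (max 0 t)} (\<lambda>s. f (x s)))" for x :: "real \<Rightarrow> 'a"
  have cf: "continuous_on A (\<lambda>s. f (apply_bcontfun x s))" for A and x :: "real \<Rightarrow>\<^sub>C 'a"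
    by (rule continuous_on_compose2[OF contf]) auto
  have cI: "continuous_on {0..h} (\<lambda>t. integral {0..t} (\<lambda>s. f (apply_bcontfun x s)))" for x
    by (intro indefinite_integral_continuous_1 integrable_continuous_real cf)
  have mem: "\<Phi> (apply_bcontfun x) \<in> bcontfun" for x
  proof -
    define u where "u = (\<lambda>t. integral {0..t} (\<lambda>s. f (apply_bcontfun x s)))"
    have "continuous_on UNIV (\<lambda>t. u (min h (max 0 t)))"
      by (rule continuous_on_compose2[OF cI[of x, folded u_def]])
         (use h in \<open>auto intro!: continuous_intros\<close>)
    moreover have "bounded (range (\<lambda>t. u (min h (max 0 t))))"
      by (rule bounded_subset[OF compact_imp_bounded[OF compact_continuous_image[OF cI[of x, folded u_def]]]])
         (use h in auto)
    ultimately show ?thesis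
      unfolding bcontfun_def \<Phi>_def
      by (auto simp: u_def intro!: continuous_intros bounded_plus_comp)
  qed
  define F where "F x = Bcontfun (\<Phi> (apply_bcontfun x))" for x
  have F: "apply_bcontfun (F x) = \<Phi> (apply_bcontfun x)" for x
    unfolding F_def using mem by (rule Bcontfun_inverse)
  have "\<exists>!x. F x = x"
  proof (rule banach_fix_type)
    show "0 \<le> L * h" "L * h < 1" using L0 h Lh by auto
    show "\<forall>x y. dist (F x) (F y) \<le> L * h * dist x y"
    proof (intro allI dist_bound)
      fix x y t
      define r where "r = min h (max 0 t)"
      have r: "0 \<le> r" "r \<le> h" using h by (auto simp: r_def)
      have "dist (F x t) (F y t) =
        norm (integral {0..r} (\<lambda>s. f (x s)) - integral {0..r} (\<lambda>s. f (y s)))"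
        by (simp add: F \<Phi>_def dist_norm r_def)
      also have "\<dots> = norm (integral {0..r} (\<lambda>s. f (x s) - f (y s)))"
        by (subst integral_diff) (auto intro!: integrable_continuous_real cf)
      also have "\<dots> \<le> (L * dist x y) * (r - 0)"
      proof (rule integral_bound)
        show "continuous_on {0..r} (\<lambda>s. f (x s) - f (y s))"
          by (intro continuous_intros cf)
        fix s
        have "norm (f (x s) - f (y s)) \<le> L * dist (x s) (y s)"
          using lipschitz_onD[OF L, of "x s" "y s"] by (simp add: dist_norm)
        also have "\<dots> \<le> L * dist x y"
          by (intro mult_left_mono dist_bounded L0)
        finally show "norm (f (x s) - f (y s)) \<le> L * dist x y" .
      qed (use r in auto)
      also have "\<dots> \<le> L * dist x y * h"
        using r L0 by (intro mult_left_mono) auto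
      finally show "dist (F x t) (F y t) \<le> L * h * dist x y"
        by (simp add: mult_ac)
    qed
  qed
  then obtain x where "F x = x" by blast
  then have x: "apply_bcontfun x = \<Phi> (apply_bcontfun x)" using F by metis
  show thesis
  proof (rule that[OF h, of "apply_bcontfun x"])
    show "x 0 = p" using h by (subst x) (simp add: \<Phi>_def)
    fix t assume t: "t \<in> {0..h}"
    \<comment> \<open>On \<open>{0..h}\<close> the clamp is the identity, so the fixed point
      equation is the integral equation there and can be differentiated.\<close>
    have "((\<lambda>u. p + integral {0..u} (\<lambda>s. f (x s))) has_vector_derivative f (x t)) (at t within {0..h})"
      by (auto intro!: derivative_eq_intros integral_has_vector_derivative[OF cf t])
    then show "(x has_vector_derivative f (x t)) (at t within {0..h})"
      by (rule has_vector_derivative_transform[OF t, rotated])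
         (subst x, auto simp: \<Phi>_def)
  qed
qed

text \<open>Precomposing with the nearest-point projection onto the ball, which is 1-Lipschitz,
  gives a globally Lipschitz field. By continuity its solution stays in the ball for a short time,
  and there the projection is the identity.\<close>

lemma picard_local_lipschitz:
  fixes f :: "'a::euclidean_space \<Rightarrow> 'a"
  assumes "L-lipschitz_on (cball p r) f" and "r > 0"
  obtains h x where "h > 0" "x 0 = p"
    "\<And>t. t \<in> {0..h} \<Longrightarrow> x t \<in> cball p r"
    "\<And>t. t \<in> {0..h} \<Longrightarrow> (x has_vector_derivative f (x t)) (at t within {0..h})"
proof -
  define c where "c = closest_point (cball p r)"
  have "1-lipschitz_on UNIV c"
    using \<open>r > 0\<close> by (auto intro!: lipschitz_onI closest_point_lipschitz simp: c_def)
  moreover have "c ` UNIV \<subseteq> cball p r"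
    using \<open>r > 0\<close> unfolding c_def image_subset_iff
    by (metis cball_eq_empty closed_cball closest_point_in_set not_less_iff_gr_or_eq)
  ultimately have "(L * 1)-lipschitz_on UNIV (\<lambda>x. f (c x))"
    using lipschitz_on_compose2[OF _ lipschitz_on_subset[OF assms(1)]] by blast
  then obtain h x where h: "h > 0" and x0: "x 0 = p" and
    x: "\<And>t. t \<in> {0..h} \<Longrightarrow> (x has_vector_derivative f (c (x t))) (at t within {0..h})"
    using picard_global_lipschitz[of "L * 1" "\<lambda>x. f (c x)" p] by metis
  have "continuous (at 0 within {0..h}) x"
    using x[of 0] h by (auto intro: has_vector_derivative_continuous)
  then obtain d where d: "d > 0" "\<And>t. t \<in> {0..h} \<Longrightarrow> dist t 0 < d \<Longrightarrow> dist (x t) (x 0) < r"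
    unfolding continuous_within_eps_delta using \<open>r > 0\<close> by metis
  \<comment> \<open>Halving \<open>d\<close> keeps the strict inequality \<open>dist t 0 < d\<close>
    valid up to the closed right end \<open>k\<close>.\<close>
  define k where "k = min h (d / 2)"
  have k: "k > 0" "k \<le> h" using h d by (auto simp: k_def)
  have ball: "x t \<in> cball p r" if "t \<in> {0..k}" for t
  proof -
    have "t \<in> {0..h}" "dist t 0 < d"
      using that d(1) by (auto simp: k_def min_def split: if_splits)
    then show ?thesis using d(2)[of t] x0 by (simp add: dist_commute)
  qed
  show thesis
  proof (rule that[of k x])
    show "0 < k" "x 0 = p" by (fact k x0)+
    show "x t \<in> cball p r" if "t \<in> {0..k}" for t
      using that by (rule ball)
    fix t assume t: "t \<in> {0..k}"
    then have "(x has_vector_derivative f (c (x t))) (at t within {0..k})"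
      using x[of t] k by (auto intro: has_vector_derivative_within_subset)
    then show "(x has_vector_derivative f (x t)) (at t within {0..k})"
      using ball[OF t] by (simp add: c_def closest_point_self)
  qed
qed

text \<open>The fundamental theorem of calculus tolerates the exceptional point \<open>c\<close>, so
  continuity and the equation elsewhere give the integral equation. Differentiating the integral
  restores the equation at \<open>c\<close> and at both ends. This is what allows two solutions to
  be glued at \<open>c\<close>.\<close>

lemma solution_across_point:
  fixes f :: "'a::banach \<Rightarrow> 'a"
  assumes contf: "continuous_on D f"
    and D: "\<And>t. t \<in> {a..b} \<Longrightarrow> x t \<in> D"
    and contx: "continuous_on {a..b} x"
    and deriv: "\<And>t. t \<in> {a<..<b} - {c} \<Longrightarrow> (x has_vector_derivative f (x t)) (at t)"
    and t: "t \<in> {a..b}"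
  shows "(x has_vector_derivative f (x t)) (at t within {a..b})"
proof -
  have cfx: "continuous_on {a..b} (\<lambda>s. f (x s))"
    by (rule continuous_on_compose2[OF contf contx]) (use D in auto)
  have int: "((\<lambda>s. f (x s)) has_integral (x u - x a)) {a..u}" if "u \<in> {a..b}" for u
    by (rule fundamental_theorem_of_calculus_interior_strong[where S = "{c}"])
       (use that in \<open>auto intro: continuous_on_subset[OF contx] intro!: deriv\<close>)
  have "((\<lambda>u. x a + integral {a..u} (\<lambda>s. f (x s))) has_vector_derivative f (x t)) (at t within {a..b})"
    by (auto intro!: derivative_eq_intros integral_has_vector_derivative[OF cfx t])
  then show ?thesis
    by (rule has_vector_derivative_transform[OF t, rotated])
       (use integral_unique[OF int] in auto)
qed

subsection \<open>Maximal solutions of autonomous equations\<close>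

lemma forward_interval_ereal [simp]: "forward_interval (ereal T) = {0..<T}"
  by (auto simp: forward_interval_def)

lemma forward_interval_PInf [simp]: "forward_interval \<infinity> = {0..}"
  by (auto simp: forward_interval_def)

lemma solves_ivp_subset:
  assumes "solves_ivp f D x0 J x" and "I \<subseteq> J"
  shows "solves_ivp f D x0 I x"
  using assms by (auto simp: solves_ivp_def intro: has_vector_derivative_within_subset)

text \<open>The field is bounded on the compact set \<open>K\<close>, so \<open>x\<close> is
  Lipschitz and has a limit at \<open>T\<close>. The limit lies in \<open>K\<close>, hence in
  \<open>D\<close>, and a local solution started there is appended.\<close>

lemma solves_ivp_extend_past_end:
  fixes f :: "'a::banach \<Rightarrow> 'a"
  assumes contf: "continuous_on D f"
    and local_existence: "\<And>p. p \<in> D \<Longrightarrow> \<exists>h>0. \<exists>z. solves_ivp f D p {0..h} z"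
    and T: "0 < T" and sol: "solves_ivp f D x0 {0..<T} x"
    and K: "compact K" "K \<subseteq> D" "x ` {0..<T} \<subseteq> K"
  obtains S y where "T < S" "solves_ivp f D x0 {0..<S} y" "\<And>t. t \<in> {0..<T} \<Longrightarrow> y t = x t"
proof -
  have dx: "(x has_vector_derivative f (x t)) (at t within {0..<T})" if "t \<in> {0..<T}" for t
    using sol that by (auto simp: solves_ivp_def)
  have "compact (f ` K)"
    using K contf by (auto intro: compact_continuous_image continuous_on_subset)
  then obtain B where B: "\<And>v. v \<in> K \<Longrightarrow> norm (f v) \<le> B"
    by (meson bounded_iff compact_imp_bounded imageI)
  have "x 0 \<in> K" using K T by auto
  then have B0: "B \<ge> 0" using B norm_ge_zero order_trans by blast
  have "B-lipschitz_on {0..<T} x"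
  proof (rule lipschitz_onI[OF _ B0])
    fix s t assume st: "s \<in> {0..<T}" "t \<in> {0..<T}"
    have "norm (x s - x t) \<le> B * norm (s - t)"
    proof (rule differentiable_bound[OF convex_real_interval(7)])
      fix u assume u: "u \<in> {0..<T}"
      show "(x has_derivative (\<lambda>h. h *\<^sub>R f (x u))) (at u within {0..<T})"
        using dx[OF u] by (simp add: has_vector_derivative_def)
      show "onorm (\<lambda>h. h *\<^sub>R f (x u)) \<le> B"
        using B[of "x u"] K u
        by (auto intro!: onorm_le mult_mono simp: mult.commute[of B] image_subset_iff)
    qed (use st in auto)
    then show "dist (x s) (x t) \<le> B * dist s t" by (simp add: dist_norm)
  qed
  then obtain g where g: "uniformly_continuous_on (closure {0..<T}) g"
    and gx: "\<And>t. t \<in> {0..<T} \<Longrightarrow> x t = g t"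
    using uniformly_continuous_on_extension_on_closure lipschitz_on_uniformly_continuous by metis
  have contg: "continuous_on {0..T} g"
    using uniformly_continuous_imp_continuous[OF g] T by simp
  \<comment> \<open>Compactness of \<open>K\<close> enters a second time here: \<open>K\<close> is
    closed, so the limit value \<open>g T\<close> cannot leave it.\<close>
  have "g ` closure {0..<T} \<subseteq> K"
    using K T contg gx by (intro image_closure_subset) (auto simp: compact_imp_closed)
  then have gK: "g t \<in> K" if "t \<in> {0..T}" for t
    using that T by auto
  then have "g T \<in> D" using K T by auto
  then obtain h z where h: "h > 0" and z: "solves_ivp f D (g T) {0..h} z"
    using local_existence by blast
  have contz: "continuous_on {0..h} z"
    using z by (auto simp: solves_ivp_def continuous_on_eq_continuous_within
        intro!: has_vector_derivative_continuous)
  \<comment> \<open>The two branches agree at the junction because \<open>z 0 = g T\<close>.\<close>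
  define w where "w t = (if t \<le> T then g t else z (t - T))" for t
  have contw: "continuous_on {0..T + h} w"
  proof -
    have "continuous_on ({0..T} \<union> {T..T + h}) w"
      unfolding w_def
    proof (rule continuous_on_cases)
      show "continuous_on {T..T + h} (\<lambda>t. z (t - T))"
        by (rule continuous_on_compose2[OF contz]) (auto intro!: continuous_intros)
    qed (use contg z T in \<open>auto simp: solves_ivp_def\<close>)
    moreover have "{0..T} \<union> {T..T + h} = {0..T + h}" using T h by auto
    ultimately show ?thesis by simp
  qed
  have wD: "w t \<in> D" if "t \<in> {0..T + h}" for t
    using that gK[of t] K z by (auto simp: w_def solves_ivp_def)
  have dw: "(w has_vector_derivative f (w t)) (at t)" if t: "t \<in> {0<..<T + h} - {T}" for t
  proof (cases "t < T")
    case True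
    with t have "(x has_vector_derivative f (x t)) (at t)"
      using dx[of t] has_vector_derivative_within_subset[of x "f (x t)" t "{0..<T}" "{0<..<T}"]
      by (auto simp: at_within_open[of t "{0<..<T}"] subset_iff)
    then have "(w has_vector_derivative f (x t)) (at t)"
      by (rule has_vector_derivative_transform_within_open[of _ _ _ "{0<..<T}"])
         (use True t gx in \<open>auto simp: w_def\<close>)
    then show ?thesis using True t gx by (simp add: w_def)
  next
    case False
    with t have t': "t - T \<in> {0<..<h}" by auto
    then have "(z has_vector_derivative f (z (t - T))) (at (t - T))"
      using z has_vector_derivative_within_subset[of z "f (z (t - T))" "t - T" "{0..h}" "{0<..<h}"]
      by (auto simp: solves_ivp_def at_within_open[of "t - T" "{0<..<h}"] subset_iff)
    \<comment> \<open>The equation is autonomous, so the time shift of \<open>z\<close> solves it as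
      well; the inner derivative contributes the factor 1.\<close>
    then have "((\<lambda>t. z (t - T)) has_vector_derivative 1 *\<^sub>R f (z (t - T))) (at t)"
      by (intro vector_diff_chain_at[of "\<lambda>t. t - T" 1 t z, unfolded o_def])
         (auto intro!: derivative_eq_intros)
    then have "(w has_vector_derivative f (z (t - T))) (at t)"
      using has_vector_derivative_transform_within_open[of _ _ t "{T<..<T + h}" w] False t
      by (simp add: w_def)
    then show ?thesis using False t by (auto simp: w_def)
  qed
  have "solves_ivp f D x0 {0..T + h} w"
    unfolding solves_ivp_def
  proof (intro conjI ballI)
    show "w 0 = x0" using T gx[of 0] sol by (auto simp: w_def solves_ivp_def)
    fix t assume "t \<in> {0..T + h}"
    then show "w t \<in> D" "(w has_vector_derivative f (w t)) (at t within {0..T + h})"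
      using wD solution_across_point[OF contf wD contw dw] by blast+
  qed
  then have "solves_ivp f D x0 {0..<T + h} w"
    by (rule solves_ivp_subset) auto
  with h show thesis
    by (intro that[of "T + h" w]) (use gx in \<open>auto simp: w_def\<close>)
qed

text \<open>Solving an equation is a local property. For \<open>c\<close> strictly between
  \<open>t\<close> and the end \<open>S\<close>, the intervals up to \<open>S\<close> and up to
  \<open>T\<close> coincide on \<open>{..<c}\<close>, so both define the same derivative at
  \<open>t\<close>. It is applied to the union of a chain of solutions.\<close>

lemma solves_ivp_forward_local:
  assumes "w 0 = x0"
    and local: "\<And>t. t \<in> forward_interval T \<Longrightarrow> \<exists>S x. S \<le> T \<and> t \<in> forward_interval S \<and>
      solves_ivp f D x0 (forward_interval S) x \<and> (\<forall>s\<in>forward_interval S. w s = x s)"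
  shows "solves_ivp f D x0 (forward_interval T) w"
  unfolding solves_ivp_def
proof (intro conjI ballI)
  fix t assume "t \<in> forward_interval T"
  then obtain S x where S: "S \<le> T" "t \<in> forward_interval S"
    and x: "solves_ivp f D x0 (forward_interval S) x"
    and wx: "\<And>s. s \<in> forward_interval S \<Longrightarrow> w s = x s"
    using local by blast
  then show "w t \<in> D" by (simp add: solves_ivp_def)
  obtain c where c: "t < c" "ereal c < S"
    using S(2) ereal_dense2[of "ereal t" S] by (auto simp: forward_interval_def)
  have "s \<in> forward_interval S" if "s \<in> forward_interval T" "s < c" for s
    using that c order.strict_trans[of "ereal s" "ereal c" S] by (auto simp: forward_interval_def)
  moreover have "s \<in> forward_interval T" if "s \<in> forward_interval S" for s
    using that S(1) by (auto simp: forward_interval_def)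
  ultimately have "at t within forward_interval T = at t within forward_interval S"
    by (intro at_within_nhd[of t "{..<c}"]) (use c in auto)
  moreover have "(w has_vector_derivative f (x t)) (at t within forward_interval S)"
    by (rule has_vector_derivative_transform[OF S(2) wx])
       (use x S in \<open>auto simp: solves_ivp_def\<close>)
  ultimately show "(w has_vector_derivative f (w t)) (at t within forward_interval T)"
    using wx[OF S(2)] by simp
qed (fact assms(1))

text \<open>Zorn's lemma, applied to the graphs of all forward solutions ordered by
  inclusion.\<close>

lemma maximal_forward_solution_exists:
  assumes "0 < T0" and "solves_ivp f D x0 (forward_interval T0) z"
  shows "\<exists>T x. maximal_forward_solution f D x0 T x"
proof -
  \<comment> \<open>A solution is a total function with arbitrary values beyond its interval. Its
    restricted graph forgets those values, so inclusion of graphs is exactly extension of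
    solutions.\<close>
  define graph where "graph = (\<lambda>T (x :: real \<Rightarrow> 'a). (\<lambda>t. (t, x t)) ` forward_interval T)"
  define A where "A = {graph T x | T x. 0 < T \<and> solves_ivp f D x0 (forward_interval T) x}"
  have graph_iff: "(t, v) \<in> graph T x \<longleftrightarrow> t \<in> forward_interval T \<and> v = x t" for t v T x
    by (auto simp: graph_def)
  have "\<exists>M\<in>A. \<forall>G\<in>A. M \<subseteq> G \<longrightarrow> G = M"
  proof (rule subset_Zorn_nonempty)
    show "A \<noteq> {}" using assms by (auto simp: A_def)
    fix C assume C: "C \<noteq> {}" "subset.chain A C"
    then have "\<forall>G\<in>C. \<exists>T x. G = graph T x \<and> 0 < T \<and> solves_ivp f D x0 (forward_interval T) x"
      by (auto simp: subset.chain_def A_def)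
    then obtain T x where Tx: "\<And>G. G \<in> C \<Longrightarrow> G = graph (T G) (x G)"
      "\<And>G. G \<in> C \<Longrightarrow> 0 < T G" "\<And>G. G \<in> C \<Longrightarrow> solves_ivp f D x0 (forward_interval (T G)) (x G)"
      by metis
    \<comment> \<open>The union of the chain is read as a function. Two members of the chain are
      comparable, so they lie in a common member and cannot give different values at one
      time.\<close>
    define w where "w t = (THE v. (t, v) \<in> \<Union>C)" for t
    have unique: "v = v'" if "(t, v) \<in> G" "(t, v') \<in> G'" "G \<in> C" "G' \<in> C" for t v v' G G'
    proof -
      have "G \<subseteq> G' \<or> G' \<subseteq> G"
        using C that by (auto simp: subset.chain_def)
      then have "(\<exists>H\<in>C. (t, v) \<in> H \<and> (t, v') \<in> H)" using that by blast
      then show ?thesis using Tx(1) graph_iff by metis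
    qed
    have w: "w t = x G t" if "G \<in> C" "t \<in> forward_interval (T G)" for t G
      unfolding w_def
    proof (rule the_equality)
      have "(t, x G t) \<in> G" using Tx(1)[OF that(1)] that graph_iff by metis
      then show "(t, x G t) \<in> \<Union>C" using that by blast
      then show "v = x G t" if "(t, v) \<in> \<Union>C" for v
        using that unique by blast
    qed
    define T' where "T' = (SUP G\<in>C. T G)"
    have T': "t \<in> forward_interval T' \<longleftrightarrow> (\<exists>G\<in>C. t \<in> forward_interval (T G))" for t
      by (auto simp: forward_interval_def T'_def less_SUP_iff)
    obtain G0 where G0: "G0 \<in> C" using C by blast
    have "0 < T'" using Tx(2)[OF G0] G0 by (auto simp: T'_def less_SUP_iff)
    moreover have "solves_ivp f D x0 (forward_interval T') w"
    proof (rule solves_ivp_forward_local)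
      have "0 \<in> forward_interval (T G0)"
        using Tx(2)[OF G0] by (simp add: forward_interval_def zero_ereal_def)
      then show "w 0 = x0"
        using w[OF G0] Tx(3)[OF G0] by (simp add: solves_ivp_def)
      fix t assume "t \<in> forward_interval T'"
      then obtain G where G: "G \<in> C" "t \<in> forward_interval (T G)" using T' by blast
      then show "\<exists>S x. S \<le> T' \<and> t \<in> forward_interval S \<and>
        solves_ivp f D x0 (forward_interval S) x \<and> (\<forall>s\<in>forward_interval S. w s = x s)"
        using Tx(3) w by (intro exI[of _ "T G"] exI[of _ "x G"]) (auto simp: T'_def intro: SUP_upper)
    qed
    moreover have "\<Union>C = graph T' w"
    proof (intro set_eqI)
      fix q :: "real \<times> 'a"
      obtain t v where q: "q = (t, v)" by fastforce
      have "q \<in> \<Union>C \<longleftrightarrow> (\<exists>G\<in>C. t \<in> forward_interval (T G) \<and> v = x G t)"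
        unfolding q using Tx(1) graph_iff by (metis Union_iff)
      also have "\<dots> \<longleftrightarrow> q \<in> graph T' w"
        unfolding q graph_iff T' using w by metis
      finally show "q \<in> \<Union>C \<longleftrightarrow> q \<in> graph T' w" .
    qed
    ultimately show "\<Union>C \<in> A" by (auto simp: A_def)
  qed
  then obtain T x where T: "0 < T" and x: "solves_ivp f D x0 (forward_interval T) x"
    and max: "\<And>G. G \<in> A \<Longrightarrow> graph T x \<subseteq> G \<Longrightarrow> G = graph T x"
    by (auto simp: A_def)
  have False if "T < S" "solves_ivp f D x0 (forward_interval S) y"
    "\<forall>t\<in>forward_interval T. y t = x t" for S y
  proof -
    have "0 < S" using T that(1) by (rule order.strict_trans)
    then have "graph S y \<in> A" using that(2) unfolding A_def by blast
    moreover have "graph T x \<subseteq> graph S y"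
      using that by (auto simp: graph_def forward_interval_def)
    ultimately have eq: "graph S y = graph T x" by (rule max)
    \<comment> \<open>A strictly later end \<open>S\<close> forces \<open>T\<close> to be a real
      number \<open>r\<close>. The time \<open>r\<close> then belongs to the interval of
      \<open>S\<close> but not to that of \<open>T\<close>, so the graphs cannot be equal.\<close>
    have "T \<noteq> \<infinity>" using that(1) by (cases S) auto
    with T obtain r where r: "T = ereal r" by (cases T) auto
    then have "r \<in> forward_interval S" "r \<notin> forward_interval T"
      using T that(1) by (auto simp: forward_interval_def)
    then show False using eq graph_iff by metis
  qed
  then show ?thesis
    using T x unfolding maximal_forward_solution_def by blast
qed

text \<open>If the end were finite, the a priori compact set would let
  \<open>solves_ivp_extend_past_end\<close> continue the solution, against maximality.\<close>

theorem maximal_forward_solutions_global: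
  fixes f :: "'a::banach \<Rightarrow> 'a"
  assumes contf: "continuous_on D f"
    and local_existence: "\<And>p. p \<in> D \<Longrightarrow> \<exists>h>0. \<exists>z. solves_ivp f D p {0..h} z"
    and x0: "x0 \<in> D"
    and a_priori: "\<And>T x. 0 < T \<Longrightarrow> solves_ivp f D x0 {0..<T} x \<Longrightarrow>
      \<exists>K. compact K \<and> K \<subseteq> D \<and> x ` {0..<T} \<subseteq> K"
  shows "\<exists>T x. maximal_forward_solution f D x0 T x"
    and "maximal_forward_solution f D x0 T x \<Longrightarrow> T = \<infinity>"
proof -
  obtain h z where h: "h > 0" "solves_ivp f D x0 {0..h} z" using local_existence[OF x0] by blast
  then have "solves_ivp f D x0 (forward_interval (ereal h)) z"
    by (auto intro: solves_ivp_subset)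
  then show "\<exists>T x. maximal_forward_solution f D x0 T x"
    using h by (intro maximal_forward_solution_exists[of "ereal h"]) auto
next
  assume max: "maximal_forward_solution f D x0 T x"
  show "T = \<infinity>"
  proof (rule ccontr)
    assume "T \<noteq> \<infinity>"
    with max obtain r where r: "T = ereal r" "0 < r"
      by (cases T) (auto simp: maximal_forward_solution_def)
    with max have x: "solves_ivp f D x0 {0..<r} x"
      by (simp add: maximal_forward_solution_def)
    from a_priori[OF r(2) x] obtain K where "compact K" "K \<subseteq> D" "x ` {0..<r} \<subseteq> K"
      by blast
    then obtain S y where "r < S" "solves_ivp f D x0 {0..<S} y" "\<And>t. t \<in> {0..<r} \<Longrightarrow> y t = x t"
      using solves_ivp_extend_past_end[OF contf local_existence r(2) x] by metis
    then have "\<exists>S y. T < S \<and> solves_ivp f D x0 (forward_interval S) y \<and>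
        (\<forall>t\<in>forward_interval T. y t = x t)"
      using r by (intro exI[of _ "ereal S"] exI[of _ y]) auto
    then show False using max by (simp add: maximal_forward_solution_def)
  qed
qed

subsection \<open>Local Lipschitz continuity\<close>

text \<open>Radius and constant are hidden so that the property has closure rules like those of
  continuity. Closed balls match the hypothesis of \<open>picard_local_lipschitz\<close>.\<close>

definition lipschitz_near :: "('a::metric_space \<Rightarrow> 'b::metric_space) \<Rightarrow> 'a \<Rightarrow> bool" where
  "lipschitz_near f p \<longleftrightarrow> (\<exists>r>0. \<exists>L. L-lipschitz_on (cball p r) f)"

lemma lipschitz_nearI:
  "r > 0 \<Longrightarrow> L-lipschitz_on (cball p r) f \<Longrightarrow> lipschitz_near f p"
  by (auto simp: lipschitz_near_def)

lemma lipschitz_near_common_ball: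
  assumes "lipschitz_near f p" "lipschitz_near g p"
  obtains r L M where "r > 0" "L-lipschitz_on (cball p r) f" "M-lipschitz_on (cball p r) g"
proof -
  from assms obtain r1 r2 L M where *: "r1 > 0" "L-lipschitz_on (cball p r1) f"
    "r2 > 0" "M-lipschitz_on (cball p r2) g"
    by (auto simp: lipschitz_near_def)
  show thesis
    by (rule that[of "min r1 r2" L M])
       (use * in \<open>auto elim!: lipschitz_on_subset\<close>)
qed

lemma lipschitz_near_const: "lipschitz_near (\<lambda>x. c) p"
  by (rule lipschitz_nearI[OF zero_less_one lipschitz_on_constant])

lemma lipschitz_near_id: "lipschitz_near (\<lambda>x. x) p"
  by (rule lipschitz_nearI[OF zero_less_one lipschitz_on_id])

lemma lipschitz_near_fst:
  assumes "lipschitz_near f p"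
  shows "lipschitz_near (\<lambda>x. fst (f x)) p"
proof -
  obtain r L where r: "r > 0" and f: "L-lipschitz_on (cball p r) f"
    using assms by (auto simp: lipschitz_near_def)
  have "L-lipschitz_on (cball p r) (\<lambda>x. fst (f x))"
    by (intro lipschitz_onI order_trans[OF dist_fst_le lipschitz_onD[OF f]] lipschitz_on_nonneg[OF f])
  with r show ?thesis by (rule lipschitz_nearI)
qed

lemma lipschitz_near_snd:
  assumes "lipschitz_near f p"
  shows "lipschitz_near (\<lambda>x. snd (f x)) p"
proof -
  obtain r L where r: "r > 0" and f: "L-lipschitz_on (cball p r) f"
    using assms by (auto simp: lipschitz_near_def)
  have "L-lipschitz_on (cball p r) (\<lambda>x. snd (f x))"
    by (intro lipschitz_onI order_trans[OF dist_snd_le lipschitz_onD[OF f]] lipschitz_on_nonneg[OF f])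
  with r show ?thesis by (rule lipschitz_nearI)
qed

lemma lipschitz_near_Pair:
  assumes "lipschitz_near f p" "lipschitz_near g p"
  shows "lipschitz_near (\<lambda>x. (f x, g x)) p"
  using assms
proof (rule lipschitz_near_common_ball)
  fix r L M
  assume "r > 0" and fg: "L-lipschitz_on (cball p r) f" "M-lipschitz_on (cball p r) g"
  show ?thesis
    by (rule lipschitz_nearI[OF \<open>r > 0\<close> lipschitz_on_Pair[OF fg]])
qed

lemma lipschitz_near_add:
  fixes f g :: "'a::metric_space \<Rightarrow> 'b::real_normed_vector"
  assumes "lipschitz_near f p" "lipschitz_near g p"
  shows "lipschitz_near (\<lambda>x. f x + g x) p"
  using assms
proof (rule lipschitz_near_common_ball)
  fix r L M
  assume "r > 0" and fg: "L-lipschitz_on (cball p r) f" "M-lipschitz_on (cball p r) g"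
  show ?thesis
    by (rule lipschitz_nearI[OF \<open>r > 0\<close> lipschitz_on_add[OF fg]])
qed

lemma lipschitz_near_diff:
  fixes f g :: "'a::metric_space \<Rightarrow> 'b::real_normed_vector"
  assumes "lipschitz_near f p" "lipschitz_near g p"
  shows "lipschitz_near (\<lambda>x. f x - g x) p"
  using assms
proof (rule lipschitz_near_common_ball)
  fix r L M
  assume "r > 0" and fg: "L-lipschitz_on (cball p r) f" "M-lipschitz_on (cball p r) g"
  show ?thesis
    by (rule lipschitz_nearI[OF \<open>r > 0\<close> lipschitz_on_diff[OF fg]])
qed

lemma lipschitz_near_imp_isCont:
  assumes "lipschitz_near f p"
  shows "isCont f p"
proof -
  obtain r L where r: "r > 0" and "L-lipschitz_on (cball p r) f"
    using assms by (auto simp: lipschitz_near_def)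
  from this(2) have "L-lipschitz_on (ball p r) f"
    by (rule lipschitz_on_subset[OF _ ball_subset_cball])
  then have "continuous_on (ball p r) f" by (rule lipschitz_on_continuous_on)
  with r show ?thesis by (simp add: continuous_on_eq_continuous_at)
qed

text \<open>On a common ball each factor is bounded by its size at the centre plus its Lipschitz
  constant times the radius. The usual splitting of a difference of products then gives the constant
  \<open>L * G + F * M\<close>.\<close>

lemma lipschitz_near_mult:
  fixes f g :: "'a::metric_space \<Rightarrow> real"
  assumes "lipschitz_near f p" "lipschitz_near g p"
  shows "lipschitz_near (\<lambda>x. f x * g x) p"
proof -
  obtain r L M where r: "r > 0" and f: "L-lipschitz_on (cball p r) f" and g: "M-lipschitz_on (cball p r) g"
    using assms by (rule lipschitz_near_common_ball)
  define F where "F = \<bar>f p\<bar> + L * r"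
  define G where "G = \<bar>g p\<bar> + M * r"
  have L0: "L \<ge> 0" "M \<ge> 0" using f g by (auto dest: lipschitz_on_nonneg)
  have F: "\<bar>f x\<bar> \<le> F" and G: "\<bar>g x\<bar> \<le> G" if "x \<in> cball p r" for x
  proof -
    have "p \<in> cball p r" "dist x p \<le> r" using r that by (auto simp: dist_commute)
    then have "dist (f x) (f p) \<le> L * r" "dist (g x) (g p) \<le> M * r"
        using lipschitz_onD[OF f that, of p] lipschitz_onD[OF g that, of p] L0
      by (meson mult_left_mono order_trans)+
    then show "\<bar>f x\<bar> \<le> F" "\<bar>g x\<bar> \<le> G" by (auto simp: F_def G_def dist_real_def)
  qed
  have "(L * G + F * M)-lipschitz_on (cball p r) (\<lambda>x. f x * g x)"
  proof (rule lipschitz_onI)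
    fix x y assume xy: "x \<in> cball p r" "y \<in> cball p r"
    have "f x * g x - f y * g y = (f x - f y) * g x + f y * (g x - g y)"
      by (simp add: algebra_simps)
    then have "dist (f x * g x) (f y * g y) \<le> dist (f x) (f y) * \<bar>g x\<bar> + \<bar>f y\<bar> * dist (g x) (g y)"
      by (simp add: dist_real_def abs_mult[symmetric] abs_triangle_ineq)
    also have "\<dots> \<le> (L * dist x y) * G + F * (M * dist x y)"
      using xy L0 lipschitz_onD[OF f] lipschitz_onD[OF g] G[OF xy(1)] F[OF xy(2)]
      by (intro add_mono mult_mono) auto
    finally show "dist (f x * g x) (f y * g y) \<le> (L * G + F * M) * dist x y"
      by (simp add: algebra_simps)
  qed (use L0 r in \<open>auto simp: F_def G_def\<close>)
  with r show ?thesis by (rule lipschitz_nearI)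
qed

text \<open>The radius is shrunk to at most \<open>s / (L + 1)\<close>, so that \<open>f\<close>
  maps the ball into the one on which \<open>g\<close> is Lipschitz; the \<open>+ 1\<close> covers
  \<open>L = 0\<close>.\<close>

lemma lipschitz_near_compose:
  assumes f: "lipschitz_near f p" and g: "lipschitz_near g (f p)"
  shows "lipschitz_near (\<lambda>x. g (f x)) p"
proof -
  obtain r L where f: "r > 0" "L-lipschitz_on (cball p r) f"
    using f by (auto simp: lipschitz_near_def)
  obtain s M where g: "s > 0" "M-lipschitz_on (cball (f p) s) g"
    using g by (auto simp: lipschitz_near_def)
  have L0: "L \<ge> 0" using f by (auto dest: lipschitz_on_nonneg)
  define k where "k = min r (s / (L + 1))"
  have k: "k > 0" using f(1) g(1) L0 by (auto simp: k_def)
  have fk: "L-lipschitz_on (cball p k) f"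
    using f(2) by (rule lipschitz_on_subset) (auto simp: k_def)
  have "f ` cball p k \<subseteq> cball (f p) s"
  proof safe
    fix x assume x: "x \<in> cball p k"
    then have "dist (f p) (f x) \<le> L * dist p x"
      using lipschitz_onD[OF fk, of p x] k by auto
    also have "\<dots> \<le> L * (s / (L + 1))"
      using x L0 by (intro mult_left_mono) (auto simp: k_def)
    also have "\<dots> \<le> s" using L0 g(1) by (auto simp: field_simps)
    finally show "f x \<in> cball (f p) s" by simp
  qed
  then have "(M * L)-lipschitz_on (cball p k) (\<lambda>x. g (f x))"
    using lipschitz_on_compose2[OF fk lipschitz_on_subset[OF g(2)]] by blast
  with k show ?thesis by (rule lipschitz_nearI)
qed

text \<open>Within distance \<open>\<bar>p\<bar> / 2\<close> of \<open>p\<close>, points keep at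
  least that distance from 0, so the denominator in \<open>(y - x) / (x * y)\<close> is at least
  \<open>r\<^sup>2\<close> in absolute value.\<close>

lemma lipschitz_near_inverse:
  assumes "(p::real) \<noteq> 0"
  shows "lipschitz_near inverse p"
proof -
  define r where "r = \<bar>p\<bar> / 2"
  have r: "r > 0" using assms by (simp add: r_def)
  have far: "\<bar>x\<bar> \<ge> r" if "x \<in> cball p r" for x
  proof -
    have "\<bar>p - x\<bar> \<le> r" using that by (simp add: dist_real_def)
    moreover have "\<bar>p\<bar> = 2 * r" by (simp add: r_def)
    ultimately show ?thesis by linarith
  qed
  have "(1 / r\<^sup>2)-lipschitz_on (cball p r) (inverse :: real \<Rightarrow> real)"
  proof (rule lipschitz_onI)
    fix x y assume "x \<in> cball p r" "y \<in> cball p r"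
    then have xy: "\<bar>x\<bar> \<ge> r" "\<bar>y\<bar> \<ge> r" by (blast intro: far)+
    then have "x \<noteq> 0" "y \<noteq> 0" using r by auto
    then have "inverse x - inverse y = (y - x) / (x * y)" by (simp add: field_simps)
    then have "dist (inverse x) (inverse y) = dist x y / (\<bar>x\<bar> * \<bar>y\<bar>)"
      unfolding dist_real_def by (simp add: abs_mult abs_minus_commute[of x y])
    also have "\<dots> \<le> dist x y / r\<^sup>2"
      using xy r unfolding power2_eq_square
      by (intro divide_left_mono mult_mono) auto
    finally show "dist (inverse x) (inverse y) \<le> 1 / r\<^sup>2 * dist x y" by simp
  qed auto
  with r show ?thesis by (rule lipschitz_nearI)
qed

lemma lipschitz_near_divide:
  fixes f g :: "'a::metric_space \<Rightarrow> real"
  assumes "lipschitz_near f p" "lipschitz_near g p" "g p \<noteq> 0"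
  shows "lipschitz_near (\<lambda>x. f x / g x) p"
  using assms unfolding divide_inverse
  by (intro lipschitz_near_mult lipschitz_near_compose[of g p inverse] lipschitz_near_inverse)

text \<open>The derivative \<open>1 - tanh z ^ 2\<close> has absolute value at most 1.\<close>

lemma lipschitz_near_tanh: "lipschitz_near tanh (p :: real)"
proof (rule lipschitz_nearI[OF zero_less_one])
  show "1-lipschitz_on (cball p 1) (tanh :: real \<Rightarrow> real)"
  proof (rule lipschitz_onI)
    fix x y :: real
    have "norm (tanh x - tanh y) \<le> 1 * norm (x - y)"
    proof (rule field_differentiable_bound[OF convex_UNIV])
      show "(tanh has_field_derivative 1 - tanh z ^ 2) (at z within UNIV)" for z :: real
        by (auto intro!: derivative_eq_intros)
      show "norm (1 - tanh z ^ 2) \<le> 1" for z :: real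
        using tanh_real_bounds[of z] abs_square_le_1[of "tanh z"] by (auto simp: abs_le_iff)
    qed auto
    then show "dist (tanh x) (tanh y) \<le> 1 * dist x y" by (simp add: dist_norm)
  qed auto
qed

lemmas lipschitz_near_intros =
  lipschitz_near_const lipschitz_near_id lipschitz_near_fst lipschitz_near_snd lipschitz_near_Pair
  lipschitz_near_add lipschitz_near_diff lipschitz_near_mult lipschitz_near_divide

section \<open>Regularity and local solvability of the follow-the-leader system\<close>

lemma lipschitz_near_optimal_velocity:
  "lipschitz_near f p \<Longrightarrow> lipschitz_near (\<lambda>x. optimal_velocity (f x)) p"
  unfolding optimal_velocity_def
  by (intro lipschitz_near_diff lipschitz_near_const lipschitz_near_tanh
      lipschitz_near_compose[of "\<lambda>x. f x - 2" p tanh])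

text \<open>Projections replace the pattern matching, so that the rules for
  \<open>lipschitz_near\<close> apply term by term and the components of a solution can be read
  off.\<close>

lemma ftl_field_conv:
  "ftl_field \<alpha> \<beta> vbar = (\<lambda>s.
    ((snd (fst s),
      - \<alpha> * (optimal_velocity (fst (fst s)) - vbar) - \<alpha> * snd (fst s)
        - \<beta> * (snd (fst s) / (fst (fst s))\<^sup>2)),
     (snd (snd s),
      - \<alpha> * (optimal_velocity (fst (snd s)) - optimal_velocity (fst (fst s))) - \<alpha> * snd (snd s)
        - \<beta> * (snd (snd s) / (fst (snd s))\<^sup>2 - snd (fst s) / (fst (fst s))\<^sup>2))))"
  by (auto simp: fun_eq_iff)

text \<open>Squares become products covered by the rules; positivity of both gaps keeps the
  denominators away from zero.\<close>

lemma lipschitz_near_ftl_field: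
  assumes "s \<in> state_space"
  shows "lipschitz_near (ftl_field \<alpha> \<beta> vbar) s"
  unfolding ftl_field_conv power2_eq_square
  by (intro lipschitz_near_intros lipschitz_near_optimal_velocity)
     (use assms in \<open>auto simp: state_space_def\<close>)

lemma open_state_space: "open state_space"
  unfolding state_space_def by (intro open_Times open_greaterThan open_UNIV)

lemma ftl_local_existence:
  assumes "p \<in> state_space"
  shows "\<exists>h>0. \<exists>z. solves_ivp (ftl_field \<alpha> \<beta> vbar) state_space p {0..h} z"
proof -
  obtain r1 L where L: "r1 > 0" "L-lipschitz_on (cball p r1) (ftl_field \<alpha> \<beta> vbar)"
    using lipschitz_near_ftl_field[OF assms] unfolding lipschitz_near_def by blast
  obtain r2 where r2: "r2 > 0" "cball p r2 \<subseteq> state_space"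
    using open_state_space assms open_contains_cball by metis
  define r where "r = min r1 r2"
  have r: "r > 0" "cball p r \<subseteq> state_space" using L r2 by (auto simp: r_def)
  moreover have "L-lipschitz_on (cball p r) (ftl_field \<alpha> \<beta> vbar)"
    using L(2) by (rule lipschitz_on_subset) (auto simp: r_def)
  ultimately obtain h x where "h > 0" "x 0 = p"
    "\<And>t. t \<in> {0..h} \<Longrightarrow> x t \<in> cball p r"
    "\<And>t. t \<in> {0..h} \<Longrightarrow> (x has_vector_derivative ftl_field \<alpha> \<beta> vbar (x t)) (at t within {0..h})"
    using picard_local_lipschitz by metis
  then show ?thesis using r unfolding solves_ivp_def by blast
qed

subsection \<open>A priori bounds\<close>

text \<open>Were \<open>u t < c\<close>, there would be a last time \<open>s\<close> before
  \<open>t\<close> with \<open>u s \<ge> c\<close>, since the set of such times is compact and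
  contains 0. After \<open>s\<close> the derivative is nonnegative, so the mean value theorem gives
  \<open>u t \<ge> u s\<close>, a contradiction.\<close>

lemma lower_barrier:
  fixes u :: "real \<Rightarrow> real"
  assumes du: "\<And>t. t \<in> {0..<T} \<Longrightarrow> (u has_real_derivative u' t) (at t within {0..<T})"
    and "u 0 \<ge> c" and barrier: "\<And>t. t \<in> {0..<T} \<Longrightarrow> u t < c \<Longrightarrow> u' t \<ge> 0"
    and t: "t \<in> {0..<T}"
  shows "u t \<ge> c"
proof (rule ccontr)
  assume less: "\<not> u t \<ge> c"
  have "continuous_on {0..<T} u"
    using du by (meson DERIV_continuous continuous_on_eq_continuous_within)
  then have contu: "continuous_on {0..t} u"
    by (rule continuous_on_subset) (use t in auto)
  define Z where "Z = {0..t} \<inter> u -` {c..}"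
  have Z: "compact Z"
    unfolding Z_def compact_eq_bounded_closed
    using contu by (auto intro: continuous_on_closed_vimage[THEN iffD1, rule_format] bounded_Int
        continuous_closed_preimage)
  moreover have "Z \<noteq> {}" using assms by (auto simp: Z_def)
  ultimately obtain s where s: "s \<in> Z" "\<And>r. r \<in> Z \<Longrightarrow> r \<le> s"
    using compact_attains_sup by metis
  have "s < t" using s(1) less by (auto simp: Z_def less_le)
  moreover have "continuous_on {s..t} u"
    by (rule continuous_on_subset[OF contu]) (use s in \<open>auto simp: Z_def\<close>)
  moreover have "(u has_derivative (\<lambda>h. h * u' r)) (at r)" if "s < r" "r < t" for r
  proof -
    have "(u has_real_derivative u' r) (at r within {0<..<T})"
      using du[of r] that s(1) t by (intro DERIV_subset[OF du]) (auto simp: Z_def)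
    then show ?thesis
      using that s(1) t by (auto simp: at_within_open[of r "{0<..<T}"] Z_def
          has_field_derivative_def mult.commute[of _ "u' r"])
  qed
  ultimately obtain r where r: "s < r" "r < t" "u t - u s = (t - s) * u' r"
    using mvt[of s t u "\<lambda>r h. h * u' r"] by auto
  have "u r < c" using s(2)[of r] r s(1) by (force simp: Z_def)
  then have "u' r \<ge> 0" using r s(1) t by (intro barrier) (auto simp: Z_def)
  then have "u t \<ge> u s" using r by (metis diff_ge_0_iff_ge less_imp_le mult_nonneg_nonneg \<open>s < t\<close>)
  then show False using s(1) less by (auto simp: Z_def)
qed

lemma upper_barrier:
  fixes u :: "real \<Rightarrow> real"
  assumes "\<And>t. t \<in> {0..<T} \<Longrightarrow> (u has_real_derivative u' t) (at t within {0..<T})"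
    and "u 0 \<le> c" and "\<And>t. t \<in> {0..<T} \<Longrightarrow> u t > c \<Longrightarrow> u' t \<le> 0"
    and "t \<in> {0..<T}"
  shows "u t \<le> c"
  using lower_barrier[of T "\<lambda>t. - u t" "\<lambda>t. - u' t" "- c" t] assms
  by (auto intro: derivative_eq_intros)

lemma bounded_of_bounded_derivative:
  fixes H :: "real \<Rightarrow> real"
  assumes dH: "\<And>t. t \<in> {0..<T} \<Longrightarrow> (H has_real_derivative H' t) (at t within {0..<T})"
    and H': "\<And>t. t \<in> {0..<T} \<Longrightarrow> \<bar>H' t\<bar> \<le> M"
    and t: "t \<in> {0..<T}"
  shows "\<bar>H t\<bar> \<le> \<bar>H 0\<bar> + M * T"
proof -
  have "norm (H t - H 0) \<le> M * norm (t - 0)"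
    by (rule field_differentiable_bound[OF convex_real_interval(7) dH]) (use H' t in auto)
  also have "\<dots> \<le> M * T"
    using t H'[OF t] by (intro mult_left_mono) auto
  finally show ?thesis by simp
qed

text \<open>This is the step common to both gaps: a bound on the conserved-type quantity is turned
  into two-sided bounds by the two barrier lemmas, the sign of \<open>\<zeta>\<close> being decided
  by \<open>\<beta> / \<xi>\<close> or by \<open>\<alpha> * \<xi>\<close>.\<close>

lemma gap_bounds:
  fixes \<xi> \<zeta> :: "real \<Rightarrow> real"
  assumes d\<xi>: "\<And>t. t \<in> {0..<T} \<Longrightarrow> (\<xi> has_real_derivative \<zeta> t) (at t within {0..<T})"
    and pos: "\<And>t. t \<in> {0..<T} \<Longrightarrow> \<xi> t > 0"
    and H: "\<And>t. t \<in> {0..<T} \<Longrightarrow> \<bar>\<zeta> t + \<alpha> * \<xi> t - \<beta> / \<xi> t\<bar> \<le> C"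
    and "0 < \<alpha>" "0 < \<beta>" "0 < T"
  obtains \<epsilon> M where "\<epsilon> > 0" "\<And>t. t \<in> {0..<T} \<Longrightarrow> \<xi> t \<in> {\<epsilon>..M} \<and> \<zeta> t \<in> {-M..M}"
proof -
  have 0: "0 \<in> {0..<T}" using assms by auto
  have C: "C \<ge> 0" using H[OF 0] by linarith
  \<comment> \<open>The three entries serve the initial condition, the estimate
    \<open>\<alpha> * \<xi> t \<le> \<alpha>\<close>, and the estimate
    \<open>\<beta> / \<xi> t > C + \<alpha>\<close>. The last two make \<open>\<zeta> t\<close>
    positive below \<open>\<epsilon>\<close>.\<close>
  define \<epsilon> where "\<epsilon> = min (\<xi> 0) (min 1 (\<beta> / (C + \<alpha>)))"
  have \<epsilon>: "\<epsilon> > 0" using pos[OF 0] C assms by (simp add: \<epsilon>_def)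
  have lower: "\<xi> t \<ge> \<epsilon>" if "t \<in> {0..<T}" for t
  proof (rule lower_barrier[OF d\<xi> _ _ that])
    fix t assume t: "t \<in> {0..<T}" and "\<xi> t < \<epsilon>"
    then have small: "\<xi> t < 1" "\<xi> t < \<beta> / (C + \<alpha>)" by (auto simp: \<epsilon>_def)
    then have "C + \<alpha> < \<beta> / \<xi> t" using pos[OF t] C \<open>0 < \<alpha>\<close> by (simp add: field_simps)
    moreover have "\<alpha> * \<xi> t \<le> \<alpha>" using small \<open>0 < \<alpha>\<close> by simp
    ultimately show "\<zeta> t \<ge> 0" using H[OF t] by linarith
  qed (auto simp: \<epsilon>_def)
  \<comment> \<open>Above \<open>M\<close> the term \<open>\<alpha> * \<xi> t\<close> exceeds
    \<open>C + \<beta> / \<epsilon>\<close>, which dominates \<open>C + \<beta> / \<xi> t\<close> by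
    the lower bound just obtained.\<close>
  define M where "M = max (\<xi> 0) ((C + \<beta> / \<epsilon>) / \<alpha>)"
  have div: "0 \<le> \<beta> / \<xi> t" "\<beta> / \<xi> t \<le> \<beta> / \<epsilon>" if "t \<in> {0..<T}" for t
    using lower[OF that] \<epsilon> \<open>0 < \<beta>\<close> by (auto intro: divide_left_mono)
  have upper: "\<xi> t \<le> M" if "t \<in> {0..<T}" for t
  proof (rule upper_barrier[OF d\<xi> _ _ that])
    fix t assume t: "t \<in> {0..<T}" and "\<xi> t > M"
    then have "C + \<beta> / \<epsilon> < \<alpha> * \<xi> t" using \<open>0 < \<alpha>\<close> by (simp add: M_def field_simps)
    then show "\<zeta> t \<le> 0" using H[OF t] div[OF t] by linarith
  qed (auto simp: M_def)
  have vel: "\<bar>\<zeta> t\<bar> \<le> C + \<alpha> * M + \<beta> / \<epsilon>" if t: "t \<in> {0..<T}" for t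
  proof -
    have "0 \<le> \<alpha> * \<xi> t" "\<alpha> * \<xi> t \<le> \<alpha> * M" using pos[OF t] upper[OF t] \<open>0 < \<alpha>\<close> by auto
    then show ?thesis using H[OF t] div[OF t] by linarith
  qed
  \<comment> \<open>One constant bounds both the gap and the speed.\<close>
  show thesis
    by (rule that[OF \<epsilon>, of "max M (C + \<alpha> * M + \<beta> / \<epsilon>)"])
       (use lower upper vel in \<open>fastforce simp: abs_le_iff\<close>)
qed

lemma optimal_velocity_diff_bound: "\<bar>optimal_velocity x - optimal_velocity y\<bar> \<le> 2"
  using tanh_real_bounds[of "x - 2"] tanh_real_bounds[of "y - 2"]
  by (auto simp: optimal_velocity_def)

lemma optimal_velocity_bound: "\<bar>optimal_velocity x\<bar> \<le> 2"
  using tanh_real_bounds[of "x - 2"] tanh_real_bounds[of "- 2"]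
  unfolding optimal_velocity_def by (simp add: abs_le_iff)

text \<open>The gaps are treated in order. The first pair evolves independently of the second, and
  its lower bound \<open>\<epsilon>1\<close> turns the coupling term \<open>\<beta> / \<xi>1\<close>
  into a bounded perturbation for the second.\<close>

lemma ftl_a_priori:
  assumes T: "0 < T" and \<alpha>: "0 < \<alpha>" and \<beta>: "0 < \<beta>"
    and sol: "solves_ivp (ftl_field \<alpha> \<beta> vbar) state_space x0 {0..<T} x"
  shows "\<exists>K. compact K \<and> K \<subseteq> state_space \<and> x ` {0..<T} \<subseteq> K"
proof -
  define \<xi>1 where "\<xi>1 t = fst (fst (x t))" for t
  define \<zeta>1 where "\<zeta>1 t = snd (fst (x t))" for t
  define \<xi>2 where "\<xi>2 t = fst (snd (x t))" for t
  define \<zeta>2 where "\<zeta>2 t = snd (snd (x t))" for t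
  note defs = \<xi>1_def \<zeta>1_def \<xi>2_def \<zeta>2_def
  have pos: "\<xi>1 t > 0" "\<xi>2 t > 0" if "t \<in> {0..<T}" for t
    using sol that by (auto simp: solves_ivp_def state_space_def defs mem_Times_iff)
  have dx: "(x has_vector_derivative ftl_field \<alpha> \<beta> vbar (x t)) (at t within {0..<T})"
    if "t \<in> {0..<T}" for t
    using sol that by (auto simp: solves_ivp_def)
  note dfst = bounded_linear.has_vector_derivative[OF bounded_linear_fst]
  note dsnd = bounded_linear.has_vector_derivative[OF bounded_linear_snd]
  have d\<xi>1: "(\<xi>1 has_real_derivative \<zeta>1 t) (at t within {0..<T})"
    and d\<xi>2: "(\<xi>2 has_real_derivative \<zeta>2 t) (at t within {0..<T})"
    and d\<zeta>1: "(\<zeta>1 has_real_derivative - \<alpha> * (optimal_velocity (\<xi>1 t) - vbar) - \<alpha> * \<zeta>1 t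
       - \<beta> * (\<zeta>1 t / (\<xi>1 t)\<^sup>2)) (at t within {0..<T})"
    and d\<zeta>2: "(\<zeta>2 has_real_derivative - \<alpha> * (optimal_velocity (\<xi>2 t) - optimal_velocity (\<xi>1 t))
       - \<alpha> * \<zeta>2 t - \<beta> * (\<zeta>2 t / (\<xi>2 t)\<^sup>2 - \<zeta>1 t / (\<xi>1 t)\<^sup>2)) (at t within {0..<T})"
    if "t \<in> {0..<T}" for t
    using dfst[OF dfst[OF dx[OF that]]] dfst[OF dsnd[OF dx[OF that]]]
      dsnd[OF dfst[OF dx[OF that]]] dsnd[OF dsnd[OF dx[OF that]]]
    unfolding has_real_derivative_iff_has_vector_derivative defs ftl_field_conv fst_conv snd_conv
    by blast+
  define G1 where "G1 t = \<zeta>1 t + \<alpha> * \<xi>1 t - \<beta> / \<xi>1 t" for t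
  have dG1: "(G1 has_real_derivative - \<alpha> * (optimal_velocity (\<xi>1 t) - vbar)) (at t within {0..<T})"
    if t: "t \<in> {0..<T}" for t
    using pos[OF t] unfolding G1_def
    by (auto intro!: derivative_eq_intros d\<xi>1[OF t] d\<zeta>1[OF t]
        simp: power2_eq_square algebra_simps)
  have bound1: "\<bar>- \<alpha> * (optimal_velocity (\<xi>1 t) - vbar)\<bar> \<le> \<alpha> * (2 + \<bar>vbar\<bar>)" for t
  proof -
    have "\<bar>optimal_velocity (\<xi>1 t) - vbar\<bar> \<le> 2 + \<bar>vbar\<bar>"
      using optimal_velocity_bound[of "\<xi>1 t"] by linarith
    then show ?thesis using \<alpha> by (simp add: abs_mult)
  qed
  have G1: "\<bar>G1 t\<bar> \<le> \<bar>G1 0\<bar> + \<alpha> * (2 + \<bar>vbar\<bar>) * T" if "t \<in> {0..<T}" for t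
    by (rule bounded_of_bounded_derivative[OF dG1 bound1 that])
  obtain \<epsilon>1 M1 where \<epsilon>1: "\<epsilon>1 > 0"
    and 1: "\<And>t. t \<in> {0..<T} \<Longrightarrow> \<xi>1 t \<in> {\<epsilon>1..M1} \<and> \<zeta>1 t \<in> {-M1..M1}"
    by (rule gap_bounds[OF d\<xi>1 pos(1) G1[unfolded G1_def] \<alpha> \<beta> T]) (assumption+, blast)
  \<comment> \<open>The extra \<open>\<beta> / \<xi>1 t\<close> has derivative
    \<open>- \<beta> * (\<zeta>1 t / (\<xi>1 t)\<^sup>2)\<close>, which cancels the term that the
    first gap contributes to the drag of the second.\<close>
  define G2 where "G2 t = \<zeta>2 t + \<alpha> * \<xi>2 t - \<beta> / \<xi>2 t + \<beta> / \<xi>1 t" for t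
  have dG2: "(G2 has_real_derivative
      - \<alpha> * (optimal_velocity (\<xi>2 t) - optimal_velocity (\<xi>1 t))) (at t within {0..<T})"
    if t: "t \<in> {0..<T}" for t
    using pos[OF t] unfolding G2_def
    by (auto intro!: derivative_eq_intros d\<xi>1[OF t] d\<xi>2[OF t] d\<zeta>2[OF t]
        simp: power2_eq_square algebra_simps)
  have bound2: "\<bar>- \<alpha> * (optimal_velocity (\<xi>2 t) - optimal_velocity (\<xi>1 t))\<bar> \<le> \<alpha> * 2" for t
    using \<alpha> optimal_velocity_diff_bound by (simp add: abs_mult)
  have G2: "\<bar>G2 t\<bar> \<le> \<bar>G2 0\<bar> + \<alpha> * 2 * T" if "t \<in> {0..<T}" for t
    by (rule bounded_of_bounded_derivative[OF dG2 bound2 that])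
  \<comment> \<open>Removing \<open>\<beta> / \<xi>1 t\<close> from \<open>G2\<close> costs at most
    \<open>\<beta> / \<epsilon>1\<close> and leaves the form required by
    \<open>gap_bounds\<close>.\<close>
  have H2: "\<bar>\<zeta>2 t + \<alpha> * \<xi>2 t - \<beta> / \<xi>2 t\<bar> \<le> \<bar>G2 0\<bar> + \<alpha> * 2 * T + \<beta> / \<epsilon>1" if t: "t \<in> {0..<T}" for t
  proof -
    have "0 \<le> \<beta> / \<xi>1 t" "\<beta> / \<xi>1 t \<le> \<beta> / \<epsilon>1"
      using 1[OF t] \<epsilon>1 \<beta> by (auto intro: divide_left_mono)
    then show ?thesis using G2[OF t] unfolding G2_def by linarith
  qed
  obtain \<epsilon>2 M2 where \<epsilon>2: "\<epsilon>2 > 0"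
    and 2: "\<And>t. t \<in> {0..<T} \<Longrightarrow> \<xi>2 t \<in> {\<epsilon>2..M2} \<and> \<zeta>2 t \<in> {-M2..M2}"
    by (rule gap_bounds[OF d\<xi>2 pos(2) H2 \<alpha> \<beta> T]) (assumption+, blast)
  show ?thesis
  proof (intro exI conjI)
    show "compact (({\<epsilon>1..M1} \<times> {-M1..M1}) \<times> ({\<epsilon>2..M2} \<times> {-M2..M2}))"
      by (intro compact_Times compact_Icc)
    show "({\<epsilon>1..M1} \<times> {-M1..M1}) \<times> ({\<epsilon>2..M2} \<times> {-M2..M2}) \<subseteq> state_space"
      using \<epsilon>1 \<epsilon>2 by (auto simp: state_space_def)
    show "x ` {0..<T} \<subseteq> ({\<epsilon>1..M1} \<times> {-M1..M1}) \<times> ({\<epsilon>2..M2} \<times> {-M2..M2})"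
      using 1 2 unfolding defs image_subset_iff mem_Times_iff by blast
  qed
qed

text \<open>Existence of a maximal solution is asserted alongside the claim about all maximal
  solutions, so that the latter is not vacuous.\<close>

theorem mainTheorem1:
  fixes vbar \<xi>1o \<zeta>1o :: real
  assumes "0 < vbar" and "vbar < 1 + tanh 2"
    and "0 < \<xi>1o" and "\<xi>1o < inv optimal_velocity vbar"
    and "0 < \<zeta>1o"
  shows "\<exists>\<alpha>0>0. \<exists>\<beta>0>0. \<forall>\<alpha>\<ge>\<alpha>0. \<forall>\<beta>\<ge>\<beta>0. \<forall>\<xi>2o>0. \<forall>\<zeta>2o.
    (\<exists>Tc x. maximal_forward_solution (ftl_field \<alpha> \<beta> vbar) state_space
        ((\<xi>1o, \<zeta>1o), (\<xi>2o, \<zeta>2o)) Tc x) \<and>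
    (\<forall>Tc x. maximal_forward_solution (ftl_field \<alpha> \<beta> vbar) state_space
        ((\<xi>1o, \<zeta>1o), (\<xi>2o, \<zeta>2o)) Tc x \<longrightarrow>
      Tc = \<infinity> \<and> (\<forall>t\<ge>0. fst (snd (x t)) > 0))"
proof (rule exI[of _ 1], intro conjI exI[of _ "1::real"] allI impI)
  fix \<alpha> \<beta> \<xi>2o \<zeta>2o :: real
  assume "1 \<le> \<alpha>" "1 \<le> \<beta>" and \<xi>2o: "0 < \<xi>2o"
  then have \<alpha>\<beta>: "0 < \<alpha>" "0 < \<beta>" by auto
  let ?f = "ftl_field \<alpha> \<beta> vbar" and ?x0 = "((\<xi>1o, \<zeta>1o), (\<xi>2o, \<zeta>2o))"
  have cont: "continuous_on state_space ?f"
    using lipschitz_near_ftl_field lipschitz_near_imp_isCont continuous_at_imp_continuous_on by metis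
  have x0: "?x0 \<in> state_space" using \<open>0 < \<xi>1o\<close> \<xi>2o by (simp add: state_space_def)
  note global = maximal_forward_solutions_global[OF cont ftl_local_existence x0 ftl_a_priori[OF _ \<alpha>\<beta>]]
  show "\<exists>Tc x. maximal_forward_solution ?f state_space ?x0 Tc x"
    by (rule global(1))
  fix Tc x assume max: "maximal_forward_solution ?f state_space ?x0 Tc x"
  then show "Tc = \<infinity>"
    by (rule global(2)[rotated -1])
  \<comment> \<open>Once \<open>Tc\<close> is infinite, the interval is \<open>{0..}\<close>, and
    absence of collision is part of membership in \<open>state_space\<close>.\<close>
  with max show "fst (snd (x t)) > 0" if "t \<ge> 0" for t
    using that by (auto simp: maximal_forward_solution_def solves_ivp_def state_space_def mem_Times_iff)
qed auto

end
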